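(* Let $(E,w)$ be a sink-separated weighted graph, and let $\widetilde E$ and $F$ be its associated auxiliary graph and $\mathcal P2$-graph, respectively. Then $F$ has no cycle with an exit if and only if the following two conditions hold: (CE1) $E$ has no cycle with an exit; (CE2) no cycle in $\widetilde E$ contains a bar edge.
   Context: A directed graph is $E=(E^0,E^1,s,r)$; $v\in E^0$ is a sink if $s^{-1}(v)=\varnothing$. A cycle is a sequence of edges $e_1\cdots e_n$, $n\ge1$, with $r(e_i)=s(e_{i+1})$, $r(e_n)=s(e_1)$ and the vertices $s(e_i)$ pairwise distinct; an exit of it is an edge $f$ with $s(f)=s(e_i)$ for some $i$ and $f\ne e_j$ for all $j$. A weighted graph $(E,w)$ is a directed graph with a map $w:E^1\to\{1,2,\dots\}$; standing assumption: nonempty, row-finite ($|s^{-1}(v)|<\infty$ for all $v$), connected. $E_w=\{e:w(e)>1\}$ is the set of weighted edges and $E_{uw}=\{e:w(e)=1\}$ the set of unweighted edges. $(E,w)$ is sink-separated if every weighted edge has range a sink of $E$, and no two distinct weighted edges have the same source or the same range. For $v\in r(E_w)$ let $g^v$ be the unique weighted edge with range $v$. Auxiliary graph $\widetilde E$: the directed graph with vertex set $E^0$ whose edges are the unweighted edges $e\in E_{uw}$ (same source and range as in $E$) together with, for each weighted edge $g\in E_w$, a bar edge $\overline g$ with source $r(g)$ and range $s(g)$. $\mathcal P2$-graph $F$ of a sink-separated $(E,w)$: the (unweighted) directed graph with vertices $E^0\setminus r(E_w)$ together with $v^{(1)},\dots,v^{(w(g^v))}$ for each $v\in r(E_w)$,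 and edges: each $e\in E_{uw}$ with $r(e)\notin r(E_w)$, with unchanged source and range; for each $e\in E_{uw}$ with $r(e)=v\in r(E_w)$, edges $e^{(i)}$ from $s(e)$ to $v^{(i)}$ for $1\le i\le w(g^v)$; for each $e\in E_w$, an edge $e^{(1)}$ from $s(e)$ to $r(e)^{(1)}$ and edges $e^{(i)}$ from $r(e)^{(i)}$ to $s(e)$ for $2\le i\le w(e)$. *)

theory Defs
  imports "Graph_Theory.Digraph_Component"
begin

text \<open>
  A weight function is only constrained on the edges of the graph.  The library predicate
  for (weak) connectedness already excludes the empty graph.
\<close>

locale weighted_graph = wf_digraph E
  for E :: "('a, 'b) pre_digraph" and w :: "'b \<Rightarrow> nat" +
  assumes row_finite: "v \<in> verts E \<Longrightarrow> finite (out_arcs E v)"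
    and connected: "Digraph_Component.connected E"
    and weight_pos: "e \<in> arcs E \<Longrightarrow> 1 \<le> w e"

definition weighted_edges :: "('a, 'b) pre_digraph \<Rightarrow> ('b \<Rightarrow> nat) \<Rightarrow> 'b set" where
  "weighted_edges E w = {e \<in> arcs E. 1 < w e}"

definition unweighted_edges :: "('a, 'b) pre_digraph \<Rightarrow> ('b \<Rightarrow> nat) \<Rightarrow> 'b set" where
  "unweighted_edges E w = {e \<in> arcs E. w e = 1}"

definition is_sink :: "('a, 'b) pre_digraph \<Rightarrow> 'a \<Rightarrow> bool" where
  "is_sink E v \<longleftrightarrow> v \<in> verts E \<and> out_arcs E v = {}"

locale sink_separated = weighted_graph E w
  for E :: "('a, 'b) pre_digraph" and w :: "'b \<Rightarrow> nat" +
  assumes range_sink: "g \<in> weighted_edges E w \<Longrightarrow> is_sink E (head E g)"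
    and inj_source: "inj_on (tail E) (weighted_edges E w)"
    and inj_range: "inj_on (head E) (weighted_edges E w)"

text \<open>
  Cycles are those of the library, where distinctness is required of the vertices
  \<open>r(e\<^sub>1), \<dots>, r(e\<^sub>n)\<close>.  As the walk is closed, these are the vertices
  \<open>s(e\<^sub>2), \<dots>, s(e\<^sub>n), s(e\<^sub>1)\<close>:
\<close>

lemma (in pre_digraph) cycle_iff_distinct_sources:
  "cycle p \<longleftrightarrow> p \<noteq> [] \<and> (\<exists>u. awalk u p u) \<and> distinct (map (tail G) p)"
proof (cases p)
  case (Cons e es)
  have "distinct (tl (awalk_verts u p)) \<longleftrightarrow> distinct (map (tail G) p)" if "awalk u p u" for u
  proof -
    have cas: "cas u p u"
      using that by (simp add: awalk_def)
    have "awalk_verts u p = u # map (head G) p"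
      using awalk_verts_conv'[OF cas] cas Cons by simp
    moreover have "awalk_verts u p = map (tail G) p @ [head G (last p)]"
      using Cons by (simp add: awalk_verts_conv)
    moreover have "cas v q z \<Longrightarrow> q \<noteq> [] \<Longrightarrow> head G (last q) = z" for v q z
      by (induction v q z rule: cas.induct) (auto split: if_splits)
    then have "head G (last p) = u"
      using cas Cons by blast
    ultimately have "u # map (head G) p = map (tail G) p @ [u]"
      by simp
    then have "mset (u # map (head G) p) = mset (map (tail G) p @ [u])"
      by (rule arg_cong)
    then have "mset (map (head G) p) = mset (map (tail G) p)"
      by simp
    with \<open>awalk_verts u p = u # map (head G) p\<close> show ?thesis
      by (metis list.sel(3) mset_eq_imp_distinct_iff)
  qed
  then show ?thesis
    by (auto simp: cycle_def)
qed (simp add: cycle_def)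

definition is_exit :: "('a, 'b) pre_digraph \<Rightarrow> 'b list \<Rightarrow> 'b \<Rightarrow> bool" where
  "is_exit E p f \<longleftrightarrow> f \<in> arcs E \<and> (\<exists>e \<in> set p. tail E f = tail E e) \<and> f \<notin> set p"

definition has_cycle_with_exit :: "('a, 'b) pre_digraph \<Rightarrow> bool" where
  "has_cycle_with_exit E \<longleftrightarrow> (\<exists>p f. pre_digraph.cycle E p \<and> is_exit E p f)"


datatype 'b aux_edge = Plain 'b | Bar 'b

definition aux_graph ::
    "('a, 'b) pre_digraph \<Rightarrow> ('b \<Rightarrow> nat) \<Rightarrow> ('a, 'b aux_edge) pre_digraph" where
  "aux_graph E w =
    \<lparr> verts = verts E,
      arcs = Plain ` unweighted_edges E w \<union> Bar ` weighted_edges E w,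
      tail = (\<lambda>x. case x of Plain e \<Rightarrow> tail E e | Bar g \<Rightarrow> head E g),
      head = (\<lambda>x. case x of Plain e \<Rightarrow> head E e | Bar g \<Rightarrow> tail E g) \<rparr>"


text \<open>
  The edge \<open>g\<^sup>v\<close>; it is determined only if \<open>v \<in> r(E\<^sub>w)\<close> and \<open>(E, w)\<close> is sink-separated.
\<close>

definition weighted_edge_into ::
    "('a, 'b) pre_digraph \<Rightarrow> ('b \<Rightarrow> nat) \<Rightarrow> 'a \<Rightarrow> 'b" where
  "weighted_edge_into E w v = (THE g. g \<in> weighted_edges E w \<and> head E g = v)"

text \<open>
  \<open>Orig x\<close> is a vertex or edge kept from \<open>E\<close>, and \<open>Copy x i\<close> stands for \<open>x\<^sup>(\<^sup>i\<^sup>)\<close>.  The source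
  of every edge of a sink-separated graph lies outside \<open>r(E\<^sub>w)\<close>, so it is always kept.
\<close>

datatype 'c p2 = Orig 'c | Copy 'c nat

definition p2_graph ::
    "('a, 'b) pre_digraph \<Rightarrow> ('b \<Rightarrow> nat) \<Rightarrow> ('a p2, 'b p2) pre_digraph" where
  "p2_graph E w =
    (let Ew = weighted_edges E w; Euw = unweighted_edges E w; R = head E ` Ew;
         m = (\<lambda>v. w (weighted_edge_into E w v))
     in \<lparr> verts = {Orig v | v. v \<in> verts E - R} \<union> {Copy v i | v i. v \<in> R \<and> 1 \<le> i \<and> i \<le> m v},
          arcs = {Orig e | e. e \<in> Euw \<and> head E e \<notin> R}
               \<union> {Copy e i | e i. e \<in> Euw \<and> head E e \<in> R \<and> 1 \<le> i \<and> i \<le> m (head E e)}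
               \<union> {Copy e i | e i. e \<in> Ew \<and> 1 \<le> i \<and> i \<le> w e},
          tail = (\<lambda>x. case x of
                    Orig e \<Rightarrow> Orig (tail E e)
                  | Copy e i \<Rightarrow> if e \<in> Ew \<and> 2 \<le> i then Copy (head E e) i else Orig (tail E e)),
          head = (\<lambda>x. case x of
                    Orig e \<Rightarrow> Orig (head E e)
                  | Copy e i \<Rightarrow> if e \<in> Ew \<and> 2 \<le> i then Orig (tail E e) else Copy (head E e) i) \<rparr>)"

context sink_separated
begin

lemma weighted_edge_into_head:
  "g \<in> weighted_edges E w \<Longrightarrow> weighted_edge_into E w (head E g) = g"
  unfolding weighted_edge_into_def using inj_range by (auto dest: inj_onD)

lemma source_not_weighted_range:
  "e \<in> arcs E \<Longrightarrow> tail E e \<notin> head E ` weighted_edges E w"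
  using range_sink by (fastforce simp: is_sink_def out_arcs_def)

lemma wf_aux_graph: "wf_digraph (aux_graph E w)"
  by unfold_locales
    (auto simp: aux_graph_def unweighted_edges_def weighted_edges_def)

lemma wf_p2_graph: "wf_digraph (p2_graph E w)"
proof
  have arcs: "e \<in> weighted_edges E w \<Longrightarrow> e \<in> arcs E" "e \<in> unweighted_edges E w \<Longrightarrow> e \<in> arcs E"
    and disj: "e \<in> unweighted_edges E w \<Longrightarrow> e \<notin> weighted_edges E w" for e
    by (simp_all add: weighted_edges_def unweighted_edges_def)
  have tails: "tail E e \<in> verts E" "g \<in> weighted_edges E w \<Longrightarrow> tail E e \<noteq> head E g"
    if "e \<in> weighted_edges E w \<or> e \<in> unweighted_edges E w" for e g
    using that source_not_weighted_range[of e] arcs[of e] by auto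
  fix x assume x: "x \<in> arcs (p2_graph E w)"
  show "tail (p2_graph E w) x \<in> verts (p2_graph E w)"
    using x by (auto simp: p2_graph_def Let_def weighted_edge_into_head disj tails)
  show "head (p2_graph E w) x \<in> verts (p2_graph E w)"
    using x by (auto simp: p2_graph_def Let_def weighted_edge_into_head arcs disj tails)
      (metis imageI weighted_edge_into_head)
qed

end

end

theory Submission
  imports Defs
begin

text \<open>
  Bar edges record which weighted edges of \<open>E\<close> can be run through backwards in the \<open>\<P>2\<close>-graph \<open>F\<close>.
  So cycles can be carried between \<open>F\<close> and the auxiliary graph by adding and forgetting superscripts.

  In one direction, the auxiliary graph embeds in \<open>F\<close>: send every \<open>v \<in> r(E\<^sub>w)\<close> to its second copy
  and every bar edge \<open>g\<close> to \<open>g\<^sup>(\<^sup>2\<^sup>)\<close>, which runs backwards just as the bar edge does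
  (\<open>aux_cycle_embeds\<close>).  A cycle of \<open>E\<close> meets no sink, so it consists of unweighted edges and is
  also a cycle of the auxiliary graph.  The image of a cycle never uses a superscript \<open>1\<close>, so the
  edges \<open>g\<^sup>(\<^sup>1\<^sup>)\<close> are available as exits: at the end \<open>s(g)\<close> of a bar edge, or in place of a
  weighted exit of a cycle of \<open>E\<close>.

  In the other direction, a copy \<open>v\<^sup>(\<^sup>i\<^sup>)\<close> is left in \<open>F\<close> only by \<open>g\<^sup>(\<^sup>i\<^sup>)\<close> with \<open>g\<close> weighted and
  \<open>2 \<le> i\<close> (\<open>p2_arc_leaving_copy\<close>).  Hence a cycle of \<open>F\<close> either consists of original edges, and is
  then a cycle of \<open>E\<close> with essentially the same exits, or traverses some \<open>g\<^sup>(\<^sup>i\<^sup>)\<close> with \<open>2 \<le> i\<close>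
  (\<open>copy_on_p2_cycle\<close>).  In the latter case it projects to a closed walk of the auxiliary graph
  through the bar edge of \<open>g\<close>, and every edge on a closed walk lies on a cycle
  (\<open>closed_walk_arc_on_cycle\<close>).
\<close>

section \<open>Closed walks and maps of digraphs\<close>

lemma (in pre_digraph) cas_tails_heads:
  "cas u p v \<Longrightarrow> insert v (tail G ` set p) = insert u (head G ` set p)"
  by (induction p arbitrary: u) (simp_all add: insert_commute)

lemma (in pre_digraph) cycle_next_arc:
  assumes "cycle p" "e \<in> set p"
  obtains f where "f \<in> set p" "tail G f = head G e"
proof -
  obtain u where u: "cas u p u"
    using assms(1) by (auto simp: cycle_def awalk_def)
  moreover have "u \<in> tail G ` set p"
    using u assms(2) by (cases p) auto
  ultimately have "tail G ` set p = insert u (head G ` set p)"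
    using cas_tails_heads by (metis insert_absorb)
  then have "head G e \<in> tail G ` set p"
    using assms(2) by auto
  then show thesis
    using that by auto
qed

lemma (in pre_digraph) cycle_arcs: "cycle p \<Longrightarrow> set p \<subseteq> arcs G"
  by (auto simp: cycle_def awalk_def)

text \<open>
  Leaving \<open>e\<close>, the rest of the closed walk leads back from \<open>r(e)\<close> to \<open>s(e)\<close>; it can be
  shortened to a path, which \<open>e\<close> closes to a cycle.
\<close>

lemma (in wf_digraph) closed_walk_arc_on_cycle:
  assumes "awalk u p u" "e \<in> set p"
  shows "\<exists>q. cycle q \<and> e \<in> set q"
proof -
  obtain xs ys where p: "p = xs @ e # ys"
    using assms(2) by (meson split_list)
  then have w: "awalk u xs (tail G e)" "awalk (head G e) ys u" and e: "e \<in> arcs G"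
    using assms(1) by (auto simp: awalk_append_iff awalk_Cons_iff)
  then have "awalk (head G e) (ys @ xs) (tail G e)"
    by (meson awalk_appendI)
  then obtain q where q: "apath (head G e) q (tail G e)"
    using apath_awalk_to_apath by blast
  then have "awalk (tail G e) (e # q) (tail G e)"
    using e by (auto simp: awalk_Cons_iff apath_def)
  then have "cycle (e # q)"
    using q by (auto simp: cycle_def apath_def)
  then show ?thesis
    by auto
qed

text \<open>
  The map need only respect incidence along the walk: the projections from \<open>F\<close> used below are
  not defined sensibly on all of its edges.
\<close>

lemma awalk_map:
  assumes "wf_digraph H" "pre_digraph.awalk G u p v" "p \<noteq> []"
    and h: "\<And>e. e \<in> set p \<Longrightarrow> he e \<in> arcs H \<and>
      tail H (he e) = hv (tail G e) \<and> head H (he e) = hv (head G e)"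
  shows "pre_digraph.awalk H (hv u) (map he p) (hv v)"
proof -
  have "pre_digraph.cas G u p v"
    using assms(2) by (simp add: pre_digraph.awalk_def)
  then have cas: "pre_digraph.cas H (hv u) (map he p) (hv v)"
    using h
  proof (induction p arbitrary: u)
    case Nil
    then show ?case by (simp add: pre_digraph.cas.simps)
  next
    case (Cons a p)
    from Cons.prems have "pre_digraph.cas H (hv (head G a)) (map he p) (hv v)"
      by (intro Cons.IH) (auto simp: pre_digraph.cas.simps)
    with Cons.prems show ?case
      by (simp add: pre_digraph.cas.simps)
  qed
  moreover have "hv u \<in> verts H"
    using \<open>p \<noteq> []\<close> cas h wf_digraph.tail_in_verts[OF assms(1)]
    by (cases p) (force simp: pre_digraph.cas.simps)+
  ultimately show ?thesis
    using h by (auto simp: pre_digraph.awalk_def)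
qed

lemma cycle_map:
  assumes "wf_digraph H" "pre_digraph.cycle G p" "inj_on hv (tail G ` set p)"
    and h: "\<And>e. e \<in> set p \<Longrightarrow> he e \<in> arcs H \<and>
      tail H (he e) = hv (tail G e) \<and> head H (he e) = hv (head G e)"
  shows "pre_digraph.cycle H (map he p)"
proof -
  from assms(2) obtain u where "p \<noteq> []" "pre_digraph.awalk G u p u"
    and d: "distinct (map (tail G) p)"
    by (auto simp: pre_digraph.cycle_iff_distinct_sources)
  moreover have "map (tail H) (map he p) = map hv (map (tail G) p)"
    using h by simp
  then have "distinct (map (tail H) (map he p))"
    using d assms(3) by (metis distinct_map list.set_map)
  moreover have "pre_digraph.awalk H (hv u) (map he p) (hv u)"
    using assms(1) \<open>pre_digraph.awalk G u p u\<close> \<open>p \<noteq> []\<close> h by (rule awalk_map)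
  ultimately show ?thesis
    by (auto simp: pre_digraph.cycle_iff_distinct_sources)
qed

section \<open>Embedding the auxiliary graph in the \<open>\<P>2\<close>-graph\<close>

context sink_separated
begin

abbreviation "F \<equiv> p2_graph E w"
abbreviation "A \<equiv> aux_graph E w"
abbreviation "Ew \<equiv> weighted_edges E w"
abbreviation "Euw \<equiv> unweighted_edges E w"
abbreviation "R \<equiv> head E ` Ew"

lemma arcs_cases: "e \<in> arcs E \<Longrightarrow> e \<in> Ew \<or> e \<in> Euw"
  using weight_pos[of e] by (auto simp: weighted_edges_def unweighted_edges_def)

lemma weighted_arcD: "e \<in> Ew \<Longrightarrow> e \<in> arcs E \<and> 2 \<le> w e"
  by (auto simp: weighted_edges_def)

lemma unweighted_arcD: "e \<in> Euw \<Longrightarrow> e \<in> arcs E \<and> e \<notin> Ew"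
  by (auto simp: weighted_edges_def unweighted_edges_def)

definition lift_vert :: "'a \<Rightarrow> 'a p2" where
  "lift_vert v = (if v \<in> R then Copy v 2 else Orig v)"

fun lift_arc :: "'b aux_edge \<Rightarrow> 'b p2" where
  "lift_arc (Plain e) = (if head E e \<in> R then Copy e 2 else Orig e)"
| "lift_arc (Bar g) = Copy g 2"

lemma Copy_1_not_lifted: "Copy e 1 \<noteq> lift_arc x"
  by (cases x) auto

lemma lift_arc_Plain_inj: "lift_arc (Plain e) = lift_arc (Plain f) \<Longrightarrow> e = f"
  by (auto split: if_splits)

text \<open>
  The second copy always exists, because weighted edges have weight at least \<open>2\<close>.
\<close>

lemma lift_arc_hom:
  assumes "x \<in> arcs A"
  shows "lift_arc x \<in> arcs F \<and> tail F (lift_arc x) = lift_vert (tail A x) \<and>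
    head F (lift_arc x) = lift_vert (head A x)"
proof (cases x)
  case (Plain e)
  then have e: "e \<in> Euw" "e \<notin> Ew"
    using assms unweighted_arcD by (auto simp: aux_graph_def)
  moreover have "tail E e \<notin> R"
    using e unweighted_arcD source_not_weighted_range by blast
  moreover have "2 \<le> w (weighted_edge_into E w (head E e))" if "head E e \<in> R"
    using that weighted_edge_into_head weighted_arcD by force
  ultimately show ?thesis
    using Plain by (auto simp: aux_graph_def p2_graph_def Let_def lift_vert_def)
next
  case (Bar g)
  then have "g \<in> Ew"
    using assms by (auto simp: aux_graph_def)
  moreover from this have "tail E g \<notin> R" "2 \<le> w g"
    using source_not_weighted_range weighted_arcD by blast+
  ultimately show ?thesis
    using Bar by (auto simp: aux_graph_def p2_graph_def Let_def lift_vert_def)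
qed

lemma aux_cycle_embeds:
  assumes "pre_digraph.cycle A p"
  shows "pre_digraph.cycle F (map lift_arc p)"
proof (rule cycle_map[OF wf_p2_graph assms])
  show "inj_on lift_vert (tail A ` set p)"
    by (auto simp: inj_on_def lift_vert_def split: if_splits)
qed (use pre_digraph.cycle_arcs[OF assms] lift_arc_hom in blast)

lemma first_copy_arc:
  assumes "g \<in> Ew"
  shows "Copy g 1 \<in> arcs F" "tail F (Copy g 1) = Orig (tail E g)"
  using assms weighted_arcD[of g] by (auto simp: p2_graph_def Let_def)

lemma bar_cycle_imp_p2_exit:
  assumes "pre_digraph.cycle A p" "Bar g \<in> set p"
  shows "has_cycle_with_exit F"
proof -
  have g: "Bar g \<in> arcs A"
    using assms pre_digraph.cycle_arcs by blast
  then have gw: "g \<in> Ew"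
    by (auto simp: aux_graph_def)
  \<comment> \<open>The exit \<open>g\<^sup>(\<^sup>1\<^sup>)\<close> shares its source \<open>s(g)\<close> with the edge that follows the bar edge.\<close>
  obtain x where x: "x \<in> set p" "tail A x = tail E g"
    using pre_digraph.cycle_next_arc[OF assms] by (auto simp: aux_graph_def)
  then have "x \<in> arcs A"
    using assms(1) pre_digraph.cycle_arcs by blast
  then have "tail F (lift_arc x) = Orig (tail E g)"
    using lift_arc_hom x(2) gw weighted_arcD source_not_weighted_range
    by (metis lift_vert_def)
  then have "is_exit F (map lift_arc p) (Copy g 1)"
    using first_copy_arc[OF gw] x(1) Copy_1_not_lifted by (force simp: is_exit_def)
  then show ?thesis
    using aux_cycle_embeds[OF assms(1)] by (auto simp: has_cycle_with_exit_def)
qed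

lemma cycle_arcs_unweighted:
  assumes "cycle p"
  shows "set p \<subseteq> Euw"
proof
  fix e assume e: "e \<in> set p"
  then obtain f where f: "f \<in> set p" "tail E f = head E e"
    using cycle_next_arc[OF assms] by metis
  then have "head E e \<notin> R"
    using cycle_arcs[OF assms] source_not_weighted_range by (metis subsetD)
  then show "e \<in> Euw"
    using arcs_cases cycle_arcs[OF assms] e by blast
qed

lemma exit_imp_p2_exit:
  assumes "has_cycle_with_exit E"
  shows "has_cycle_with_exit F"
proof -
  obtain p f where p: "cycle p" and "is_exit E p f"
    using assms by (auto simp: has_cycle_with_exit_def)
  then obtain e where e: "e \<in> set p" "tail E f = tail E e" and f: "f \<in> arcs E" "f \<notin> set p"
    by (auto simp: is_exit_def)
  have plain: "x \<in> Euw \<Longrightarrow> Plain x \<in> arcs A" "tail A (Plain x) = tail E x" for x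
    by (auto simp: aux_graph_def)
  have unw: "set p \<subseteq> Euw"
    using p by (rule cycle_arcs_unweighted)
  have "pre_digraph.cycle A (map Plain p)"
    using wf_aux_graph p
  proof (rule cycle_map[where hv = id])
    show "Plain x \<in> arcs A \<and> tail A (Plain x) = id (tail E x) \<and> head A (Plain x) = id (head E x)"
      if "x \<in> set p" for x
      using that unw by (auto simp: aux_graph_def)
  qed simp
  then have cyc: "pre_digraph.cycle F (map lift_arc (map Plain p))"
    by (rule aux_cycle_embeds)
  have tail_lift: "tail F (lift_arc (Plain x)) = Orig (tail E x)" if "x \<in> Euw" for x
    using lift_arc_hom plain that unweighted_arcD source_not_weighted_range
    by (metis lift_vert_def)
  \<comment> \<open>A weighted exit \<open>f\<close> is no edge of the auxiliary graph; its first copy replaces it.\<close>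
  define f' where "f' = (if f \<in> Ew then Copy f 1 else lift_arc (Plain f))"
  have "f' \<in> arcs F \<and> tail F f' = Orig (tail E f)"
    using first_copy_arc lift_arc_hom plain tail_lift arcs_cases[OF f(1)]
    by (auto simp only: f'_def split: if_splits)
  moreover have "f' \<notin> set (map lift_arc (map Plain p))"
    using f(2) Copy_1_not_lifted lift_arc_Plain_inj
    by (auto simp only: f'_def set_map image_iff split: if_splits)
  moreover have "tail F (lift_arc (Plain e)) = Orig (tail E f)"
    using tail_lift[of e] e unw by (metis subsetD)
  moreover have "lift_arc (Plain e) \<in> set (map lift_arc (map Plain p))"
    using e(1) by (simp del: lift_arc.simps)
  ultimately have "is_exit F (map lift_arc (map Plain p)) f'"
    unfolding is_exit_def by metis
  with cyc show ?thesis
    by (auto simp: has_cycle_with_exit_def)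
qed

section \<open>Projecting cycles of the \<open>\<P>2\<close>-graph\<close>

lemma p2_arc_leaving_copy:
  assumes "x \<in> arcs F" "tail F x = Copy v i"
  shows "2 \<le> i \<and> (\<exists>g \<in> Ew. x = Copy g i)"
  using assms by (auto simp: p2_graph_def Let_def split: if_splits)

text \<open>
  Unless \<open>e\<^sup>(\<^sup>i\<^sup>)\<close> already is of the required form, it ends in a copy, which the cycle must leave.
\<close>

lemma copy_on_p2_cycle:
  assumes "pre_digraph.cycle F p" "Copy e i \<in> set p"
  shows "2 \<le> i \<and> (\<exists>g \<in> Ew. Copy g i \<in> set p)"
proof (cases "e \<in> Ew \<and> 2 \<le> i")
  case False
  then have "head F (Copy e i) = Copy (head E e) i"
    by (auto simp: p2_graph_def Let_def)
  then obtain x where "x \<in> set p" "tail F x = Copy (head E e) i"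
    using pre_digraph.cycle_next_arc[OF assms] by metis
  then show ?thesis
    using p2_arc_leaving_copy pre_digraph.cycle_arcs[OF assms(1)] by blast
qed (use assms(2) in auto)

fun base :: "'c p2 \<Rightarrow> 'c" where
  "base (Orig x) = x"
| "base (Copy x i) = x"

definition proj_arc :: "'b p2 \<Rightarrow> 'b aux_edge" where
  "proj_arc x = (case x of
     Orig e \<Rightarrow> Plain e
   | Copy e i \<Rightarrow> if e \<in> Ew then Bar e else Plain e)"

text \<open>
  The edges \<open>g\<^sup>(\<^sup>1\<^sup>)\<close> with \<open>g\<close> weighted, which \<open>proj_arc\<close> would reverse, are dead ends and
  therefore lie on no cycle.
\<close>

lemma proj_arc_hom:
  assumes "pre_digraph.cycle F p" "x \<in> set p"
  shows "proj_arc x \<in> arcs A \<and> tail A (proj_arc x) = base (tail F x) \<and>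
    head A (proj_arc x) = base (head F x)"
proof (cases x)
  case (Orig e)
  moreover have "x \<in> arcs F"
    using assms pre_digraph.cycle_arcs by blast
  ultimately show ?thesis
    by (auto simp: aux_graph_def p2_graph_def Let_def proj_arc_def)
next
  case (Copy e i)
  moreover have "x \<in> arcs F" "2 \<le> i"
    using assms pre_digraph.cycle_arcs copy_on_p2_cycle Copy by blast+
  ultimately show ?thesis
    by (auto simp: aux_graph_def p2_graph_def Let_def proj_arc_def)
qed

lemma p2_cycle_with_copy_imp_bar_cycle:
  assumes "pre_digraph.cycle F p" "Copy e i \<in> set p"
  shows "\<exists>q g. pre_digraph.cycle A q \<and> Bar g \<in> set q"
proof -
  obtain g where g: "g \<in> Ew" "Copy g i \<in> set p"
    using copy_on_p2_cycle[OF assms] by blast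
  obtain u where "pre_digraph.awalk F u p u" "p \<noteq> []"
    using assms(1) by (auto simp: pre_digraph.cycle_def)
  then have "pre_digraph.awalk A (base u) (map proj_arc p) (base u)"
    by (intro awalk_map[OF wf_aux_graph]) (use proj_arc_hom[OF assms(1)] in auto)
  moreover have "Bar g = proj_arc (Copy g i)"
    using g(1) by (simp add: proj_arc_def)
  then have "Bar g \<in> set (map proj_arc p)"
    using g(2) by simp
  ultimately show ?thesis
    using wf_digraph.closed_walk_arc_on_cycle[OF wf_aux_graph] by blast
qed

text \<open>
  Outside the copies, \<open>F\<close> is part of \<open>E\<close>.  An exit of such a cycle may itself be a copy \<open>f\<^sup>(\<^sup>i\<^sup>)\<close>;
  then \<open>f\<close> is weighted or ends in \<open>r(E\<^sub>w)\<close>, and thus differs from the edges of the cycle.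
\<close>

lemma p2_exit_without_copy_imp_exit:
  assumes cyc: "pre_digraph.cycle F p" and exit: "is_exit F p f"
    and nocopy: "\<And>e i. Copy e i \<notin> set p"
  shows "has_cycle_with_exit E"
proof -
  have orig: "\<exists>e. x = Orig e \<and> e \<in> Euw \<and> head E e \<notin> R" if x: "x \<in> set p" for x
  proof -
    obtain e where "x = Orig e"
      using nocopy x by (cases x) auto
    moreover have "x \<in> arcs F"
      using x cyc pre_digraph.cycle_arcs by blast
    ultimately show ?thesis
      by (auto simp: p2_graph_def Let_def)
  qed
  have tail_Orig: "tail F (Orig e) = Orig (tail E e)" and
    head_Orig: "head F (Orig e) = Orig (head E e)" for e
    by (auto simp: p2_graph_def Let_def)
  have "cycle (map base p)"
    using wf_digraph_axioms cyc
  proof (rule cycle_map[where hv = base])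
    have "tail F ` set p \<subseteq> range Orig"
      using orig tail_Orig by fastforce
    moreover have "inj_on base (range Orig)"
      by (auto intro: inj_onI)
    ultimately show "inj_on base (tail F ` set p)"
      by (rule inj_on_subset[rotated])
    show "base x \<in> arcs E \<and> tail E (base x) = base (tail F x) \<and> head E (base x) = base (head F x)"
      if "x \<in> set p" for x
      using orig[OF that] unweighted_arcD by (auto simp: tail_Orig head_Orig)
  qed
  moreover
  obtain x where x: "x \<in> set p" "tail F f = tail F x" and f: "f \<in> arcs F" "f \<notin> set p"
    using exit by (auto simp: is_exit_def)
  obtain e where e: "x = Orig e"
    using orig x(1) by blast
  then have "tail F f = Orig (tail E e)"
    using x(2) tail_Orig by simp
  then have "base f \<in> arcs E \<and> tail E (base f) = tail E (base x)"
    using f(1) e unweighted_arcD weighted_arcD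
    by (auto simp: p2_graph_def Let_def split: if_splits)
  moreover have "base f \<notin> set (map base p)"
  proof
    assume "base f \<in> set (map base p)"
    then obtain y where y: "y \<in> set p" "base f = base y"
      by auto
    with orig have "y = Orig (base f)" "base f \<in> Euw" "head E (base f) \<notin> R"
      by fastforce+
    then show False
      using y(1) f unweighted_arcD by (cases f) (auto simp: p2_graph_def Let_def)
  qed
  moreover have "base x \<in> set (map base p)"
    using x(1) by simp
  ultimately show ?thesis
    unfolding has_cycle_with_exit_def is_exit_def by blast
qed

end

theorem proposition4p13:
  fixes E :: "('a, 'b) pre_digraph" and w :: "'b \<Rightarrow> nat"
  assumes "sink_separated E w"
  shows "\<not> has_cycle_with_exit (p2_graph E w) \<longleftrightarrow>
    \<not> has_cycle_with_exit E \<and>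
    (\<nexists>p g. pre_digraph.cycle (aux_graph E w) p \<and> Bar g \<in> set p)"
proof -
  interpret sink_separated E w
    by (rule assms)
  have "has_cycle_with_exit E \<or> (\<exists>p g. pre_digraph.cycle A p \<and> Bar g \<in> set p)"
    if F: "has_cycle_with_exit F"
  proof -
    obtain p f where p: "pre_digraph.cycle F p" "is_exit F p f"
      using F by (auto simp: has_cycle_with_exit_def)
    show ?thesis
    proof (cases "\<exists>e i. Copy e i \<in> set p")
      case True
      then show ?thesis
        using p2_cycle_with_copy_imp_bar_cycle[OF p(1)] by blast
    next
      case False
      then show ?thesis
        using p2_exit_without_copy_imp_exit[OF p] by blast
    qed
  qed
  then show ?thesis
    using exit_imp_p2_exit bar_cycle_imp_p2_exit by blast
qed

end
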